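(* Let $G$ be a finite non-nilpotent group. The nilpotent graph $\Gamma_{\mathfrak N}(G)$ is bipartite if and only if $G\cong S_3$, the symmetric group of degree three.
   Context: For a finite group $G$, $\mathrm{nil}(G)=\{g\in G:\langle g,h\rangle \text{ is nilpotent for all } h\in G\}$. For a finite non-nilpotent group $G$, the nilpotent graph $\Gamma_{\mathfrak N}(G)$ is the simple undirected graph with vertex set $G-\mathrm{nil}(G)$ (set difference) in which two distinct vertices $g,h$ are adjacent if and only if $\langle g,h\rangle$ is nilpotent. A graph is bipartite if its vertices can be divided into two disjoint sets such that every edge joins a vertex of one set to a vertex of the other. *)

theory Defs
  imports "HOL-Algebra.Algebra" "Graph_Theory.Pair_Digraph"
begin

section \<open>Nilpotent groups\<close>

definition commutator_subgroup :: "('a, 'b) monoid_scheme \<Rightarrow> 'a set \<Rightarrow> 'a set \<Rightarrow> 'a set" where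
  "commutator_subgroup G H K =
     generate G (\<Union>h \<in> H. \<Union>k \<in> K. { h \<otimes>\<^bsub>G\<^esub> k \<otimes>\<^bsub>G\<^esub> inv\<^bsub>G\<^esub> h \<otimes>\<^bsub>G\<^esub> inv\<^bsub>G\<^esub> k })"

primrec lower_central_series :: "('a, 'b) monoid_scheme \<Rightarrow> nat \<Rightarrow> 'a set" where
  "lower_central_series G 0 = carrier G"
| "lower_central_series G (Suc n) = commutator_subgroup G (lower_central_series G n) (carrier G)"

definition nilpotent :: "('a, 'b) monoid_scheme \<Rightarrow> bool" where
  "nilpotent G \<longleftrightarrow> group G \<and> (\<exists>n. lower_central_series G n = { \<one>\<^bsub>G\<^esub> })"


section \<open>The nilpotent graph\<close>

definition nil_set :: "('a, 'b) monoid_scheme \<Rightarrow> 'a set" where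
  "nil_set G =
     {g \<in> carrier G. \<forall>h \<in> carrier G. nilpotent (G \<lparr> carrier := generate G {g, h} \<rparr>)}"

text \<open>
  A simple undirected graph is encoded as a symmetric loop-free set of ordered pairs, i.e. as an
  instance of the locale \<^locale>\<open>pair_graph\<close>.
\<close>

definition nilpotent_graph :: "('a, 'b) monoid_scheme \<Rightarrow> 'a pair_pre_digraph" where
  "nilpotent_graph G =
     \<lparr> pverts = carrier G - nil_set G,
       parcs = {(g, h). g \<in> carrier G - nil_set G \<and> h \<in> carrier G - nil_set G \<and> g \<noteq> h \<and>
                  nilpotent (G \<lparr> carrier := generate G {g, h} \<rparr>)} \<rparr>"

lemma pair_graph_nilpotent_graph:
  assumes "finite (carrier G)"
  shows "pair_graph (nilpotent_graph G)"
proof -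
  let ?V = "carrier G - nil_set G"
  have "parcs (nilpotent_graph G) \<subseteq> ?V \<times> ?V"
    by (auto simp: nilpotent_graph_def)
  then have "finite (parcs (nilpotent_graph G))"
    using assms by (meson finite_Diff finite_SigmaI finite_subset)
  moreover have "sym (parcs (nilpotent_graph G))"
    by (auto simp: sym_def nilpotent_graph_def insert_commute)
  ultimately show ?thesis
    using assms
    by unfold_locales (auto simp: nilpotent_graph_def symmetric_def)
qed


section \<open>Bipartite graphs\<close>

definition bipartite :: "'a pair_pre_digraph \<Rightarrow> bool" where
  "bipartite \<Gamma> \<longleftrightarrow>
     (\<exists>A B. A \<inter> B = {} \<and> A \<union> B = pverts \<Gamma> \<and>
        (\<forall>(u, v) \<in> parcs \<Gamma>. u \<in> A \<and> v \<in> B \<or> u \<in> B \<and> v \<in> A))"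

end

theory Submission
  imports Defs
begin

text \<open>
  The nilpotent graph of a finite non-nilpotent group \<open>G\<close> has a triangle unless \<open>G\<close> has order six, and
  in such a group of order six every edge joins a vertex to its inverse.

  Two facts about nilpotency drive the proof. In a nilpotent group, elements of coprime order commute
  (\<open>nilpotent_coprime_commute\<close>). Conversely, a finite group is nilpotent if elements whose orders are
  powers of distinct primes commute (\<open>primary_commuting_nilpotent\<close>). So a finite non-nilpotent group
  contains non-commuting \<open>x\<close> and \<open>y\<close> of orders powers of distinct primes, and both are vertices. One of
  the primes is odd, say that of \<open>x\<close>. Then \<open>x\<close>, \<open>x [^] 2\<close> and \<open>inv x\<close> are commuting vertices; if the graph
  has no triangle, two of them coincide, which forces \<open>x\<close> to have order three
  (\<open>odd_order_vertex_cube\<close>).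

  Any further vertex commuting with \<open>x\<close> would complete \<open>x\<close> and \<open>x [^] 2\<close> to a triangle. This makes the subgroup
  generated by \<open>x\<close> its own centralizer (\<open>self_centralizing\<close>), and then \<open>nil_set G\<close> is trivial: for \<open>c\<close> in
  it, the centre of the nilpotent group generated by \<open>c\<close> and \<open>x\<close> centralizes \<open>x\<close>, so it is generated by
  \<open>x\<close>, and \<open>c\<close> centralizes \<open>x\<close> as well (\<open>nil_set_trivial\<close>). Now all nontrivial elements are vertices. As
  subgroups of prime power order are nilpotent, they are cliques up to \<open>\<one>\<close> and have at most three
  elements; by Sylow's theorem the order of \<open>G\<close> divides six, and it is six because the proper divisors
  of six are prime powers (\<open>order_eq_six\<close>). A non-nilpotent group of order six has the multiplication
  table of the symmetric group of degree three (\<open>order_six_iso_sym_group\<close>).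
\<close>

section \<open>The lower central series\<close>

lemma (in group) inv_mult_cancel:
  assumes "x \<in> carrier G" "y \<in> carrier G"
  shows "inv x \<otimes> (x \<otimes> y) = y" "x \<otimes> (inv x \<otimes> y) = y"
  using assms by (simp_all add: m_assoc[symmetric])

lemma (in group) normal_commutator_subgroup:
  assumes "N \<lhd> G"
  shows "commutator_subgroup G N (carrier G) \<lhd> G"
  unfolding commutator_subgroup_def
proof (rule normal_generateI)
  have N: "N \<subseteq> carrier G"
    using assms by (meson normal_imp_subgroup subgroup.subset)
  then show "(\<Union>h\<in>N. \<Union>k\<in>carrier G. {h \<otimes> k \<otimes> inv h \<otimes> inv k}) \<subseteq> carrier G"
    by auto
  fix c g
  assume c: "c \<in> (\<Union>h\<in>N. \<Union>k\<in>carrier G. {h \<otimes> k \<otimes> inv h \<otimes> inv k})" and g: "g \<in> carrier G"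
  then obtain h k where h: "h \<in> N" "h \<in> carrier G" and k: "k \<in> carrier G"
    and c_eq: "c = h \<otimes> k \<otimes> inv h \<otimes> inv k"
    using N by auto
  have "g \<otimes> c \<otimes> inv g = (g \<otimes> h \<otimes> inv g) \<otimes> (g \<otimes> k \<otimes> inv g) \<otimes> inv (g \<otimes> h \<otimes> inv g) \<otimes> inv (g \<otimes> k \<otimes> inv g)"
    using g h k by (simp add: c_eq m_assoc inv_mult_group inv_mult_cancel)
  moreover have "g \<otimes> h \<otimes> inv g \<in> N"
    using assms g h by (simp add: normal_inv_iff)
  moreover have "g \<otimes> k \<otimes> inv g \<in> carrier G"
    using g k by simp
  ultimately show "g \<otimes> c \<otimes> inv g \<in> (\<Union>h\<in>N. \<Union>k\<in>carrier G. {h \<otimes> k \<otimes> inv h \<otimes> inv k})"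
    by blast
qed

lemma (in group) normal_lower_central_series: "lower_central_series G n \<lhd> G"
  by (induction n) (auto simp: normal_self normal_commutator_subgroup)

lemma (in group) lower_central_series_subset_carrier: "lower_central_series G n \<subseteq> carrier G"
  using normal_lower_central_series by (meson normal_imp_subgroup subgroup.subset)

lemma (in group) commutator_in_lower_central_series:
  assumes "x \<in> lower_central_series G n" "y \<in> carrier G"
  shows "x \<otimes> y \<otimes> inv x \<otimes> inv y \<in> lower_central_series G (Suc n)"
  using assms by (auto simp: commutator_subgroup_def intro!: generate.incl)

text \<open>Commutators and generated subgroups are the same in \<open>K\<close> as in \<open>G\<close>, so each term for \<open>K\<close> is
  generated by some of the generators of the term for \<open>G\<close>.\<close>
lemma (in group) lower_central_series_subgroup_subset:
  assumes "subgroup K G"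
  shows "lower_central_series (G\<lparr>carrier := K\<rparr>) n \<subseteq> lower_central_series G n"
proof (induction n)
  case 0
  then show ?case using assms by (simp add: subgroup.subset)
next
  case (Suc n)
  let ?K = "G\<lparr>carrier := K\<rparr>"
  interpret K: group ?K using assms by (rule subgroup_imp_group)
  have K: "K \<subseteq> carrier G" using assms by (rule subgroup.subset)
  have lcs: "lower_central_series ?K n \<subseteq> K"
    using K.lower_central_series_subset_carrier by simp
  let ?S = "\<Union>h\<in>lower_central_series ?K n. \<Union>k\<in>K. {h \<otimes> k \<otimes> inv h \<otimes> inv k}"
  have "lower_central_series ?K (Suc n) = generate ?K ?S"
    using lcs assms by (auto simp: commutator_subgroup_def intro!: arg_cong[where f = "generate ?K"])
      (metis m_inv_consistent subsetD)+
  also have "\<dots> = generate G ?S"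
    using lcs assms
    by (intro generate_consistent) (auto intro!: subgroup.m_closed subgroup.m_inv_closed)
  also have "\<dots> \<subseteq> lower_central_series G (Suc n)"
    unfolding lower_central_series.simps commutator_subgroup_def
    using Suc K by (intro mono_generate) blast
  finally show ?case .
qed

lemma (in group) nilpotent_subgroup:
  assumes "nilpotent G" "subgroup K G"
  shows "nilpotent (G\<lparr>carrier := K\<rparr>)"
proof -
  interpret K: group "G\<lparr>carrier := K\<rparr>" using assms(2) by (rule subgroup_imp_group)
  obtain n where "lower_central_series G n = {\<one>}"
    using assms(1) by (auto simp: nilpotent_def)
  then have "lower_central_series (G\<lparr>carrier := K\<rparr>) n \<subseteq> {\<one>}"
    using lower_central_series_subgroup_subset[OF assms(2), of n] by simp
  moreover have "\<one> \<in> lower_central_series (G\<lparr>carrier := K\<rparr>) n"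
    using subgroup.one_closed[OF normal_imp_subgroup[OF K.normal_lower_central_series]] by simp
  ultimately have "lower_central_series (G\<lparr>carrier := K\<rparr>) n = {\<one>\<^bsub>G\<lparr>carrier := K\<rparr>\<^esub>}"
    by auto
  then show ?thesis
    using K.is_group unfolding nilpotent_def by blast
qed

lemma (in group) nilpotent_subgroup_mono:
  assumes "subgroup K G" "subgroup L G" "K \<subseteq> L" "nilpotent (G\<lparr>carrier := L\<rparr>)"
  shows "nilpotent (G\<lparr>carrier := K\<rparr>)"
  using group.nilpotent_subgroup[OF subgroup_imp_group[OF assms(2)] assms(4) subgroup_incl[OF assms(1-3)]]
  by simp

lemma (in group) nilpotent_abelian:
  assumes "\<And>x y. x \<in> carrier G \<Longrightarrow> y \<in> carrier G \<Longrightarrow> x \<otimes> y = y \<otimes> x"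
  shows "nilpotent G"
proof -
  have "x \<otimes> y \<otimes> inv x \<otimes> inv y = \<one>" if "x \<in> carrier G" "y \<in> carrier G" for x y
    using that by (simp add: assms[of x y] m_assoc inv_mult_cancel)
  then have "(\<Union>h\<in>carrier G. \<Union>k\<in>carrier G. {h \<otimes> k \<otimes> inv h \<otimes> inv k}) = {\<one>}"
    by auto
  then have "lower_central_series G 1 = {\<one>}"
    by (simp add: commutator_subgroup_def generate_one)
  then show ?thesis
    using is_group unfolding nilpotent_def by blast
qed

text \<open>The last nontrivial term of the lower central series is central.\<close>

lemma (in group) nilpotent_center_nontrivial:
  assumes "nilpotent G" "carrier G \<noteq> {\<one>}"
  obtains z where "z \<in> carrier G" "z \<noteq> \<one>" "\<And>g. g \<in> carrier G \<Longrightarrow> z \<otimes> g = g \<otimes> z"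
proof -
  define n where "n = (LEAST n. lower_central_series G n = {\<one>})"
  have n: "lower_central_series G n = {\<one>}"
    unfolding n_def using assms(1) by (metis (mono_tags, lifting) LeastI nilpotent_def)
  then obtain m where m: "n = Suc m"
    using assms(2) by (cases n) auto
  then have "lower_central_series G m \<noteq> {\<one>}"
    using not_less_Least[of m "\<lambda>n. lower_central_series G n = {\<one>}"] unfolding n_def by auto
  moreover have "\<one> \<in> lower_central_series G m"
    using normal_lower_central_series by (meson normal_imp_subgroup subgroup.one_closed)
  ultimately obtain z where z: "z \<in> lower_central_series G m" "z \<noteq> \<one>"
    by blast
  then have zG: "z \<in> carrier G"
    using lower_central_series_subset_carrier by blast
  moreover have "z \<otimes> g = g \<otimes> z" if g: "g \<in> carrier G" for g
  proof -
    have "z \<otimes> g \<otimes> inv z \<otimes> inv g = \<one>"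
      using commutator_in_lower_central_series[OF z(1) g] n m by blast
    then have "z \<otimes> g \<otimes> inv (g \<otimes> z) = \<one>"
      using zG g by (simp add: inv_mult_group m_assoc)
    then show ?thesis
      using zG g inv_solve_right' by simp
  qed
  ultimately show thesis
    using z that by blast
qed


section \<open>Elements of coprime order in a nilpotent group\<close>

lemma (in normal) FactGroup_commute_iff:
  assumes "x \<in> carrier G" "y \<in> carrier G"
  shows "(H #> x) \<otimes>\<^bsub>G Mod H\<^esub> (H #> y) = (H #> y) \<otimes>\<^bsub>G Mod H\<^esub> (H #> x)
    \<longleftrightarrow> x \<otimes> y \<otimes> inv x \<otimes> inv y \<in> H"
proof -
  have "H #> (x \<otimes> y) = H #> (y \<otimes> x) \<longleftrightarrow> H #> (x \<otimes> y \<otimes> inv (y \<otimes> x)) = H"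
    using assms subset by (metis coset_mult_inv1 coset_mult_inv2 m_closed)
  also have "\<dots> \<longleftrightarrow> x \<otimes> y \<otimes> inv (y \<otimes> x) \<in> H"
    using assms by (meson coset_join1 coset_join2 inv_closed is_subgroup m_closed)
  also have "x \<otimes> y \<otimes> inv (y \<otimes> x) = x \<otimes> y \<otimes> inv x \<otimes> inv y"
    using assms by (simp add: inv_mult_group m_assoc)
  finally show ?thesis
    using assms by (simp add: rcos_sum)
qed

lemma (in group) pow_coprime_eq_one:
  assumes "x \<in> carrier G" "x [^] m = \<one>" "x [^] n = \<one>" "coprime m (n::nat)"
  shows "x = \<one>"
proof -
  have "ord x dvd m" "ord x dvd n"
    using assms by (simp_all add: pow_eq_id)
  then have "ord x = 1"
    using assms(4) by (metis coprime_common_divisor_nat nat_dvd_1_iff_1)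
  then show ?thesis
    using assms(1) ord_eq_1 by blast
qed

text \<open>For \<open>x [^] k = \<one>\<close> this gives \<open>c [^] k = \<one>\<close>, so the order of the commutator \<open>c\<close> of \<open>x\<close> and
  \<open>y\<close> divides that of \<open>x\<close>. Exchanging \<open>x\<close> and \<open>y\<close> inverts the commutator, so if \<open>c\<close> commutes with \<open>y\<close>
  as well, its order also divides that of \<open>y\<close>.\<close>

lemma (in group) central_commutator_pow:
  assumes "x \<in> carrier G" "y \<in> carrier G" "c \<in> carrier G"
    and "x \<otimes> y = c \<otimes> (y \<otimes> x)" "c \<otimes> x = x \<otimes> c"
  shows "x [^] (k::nat) \<otimes> y = c [^] k \<otimes> (y \<otimes> x [^] k)"
proof (induction k)
  case 0
  then show ?case using assms by simp
next
  case (Suc k)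
  have comm: "x [^] k \<otimes> c = c \<otimes> x [^] k"
    using group_commutes_pow[of x c k] assms by simp
  have "x [^] Suc k \<otimes> y = x [^] k \<otimes> (c \<otimes> (y \<otimes> x))"
    using assms by (simp add: m_assoc)
  also have "\<dots> = c \<otimes> (x [^] k \<otimes> y) \<otimes> x"
    using assms(1-3) by (simp add: m_assoc[symmetric] comm)
  also have "\<dots> = c \<otimes> c [^] k \<otimes> (y \<otimes> x [^] Suc k)"
    using assms(1-3) by (simp add: Suc m_assoc)
  also have "c \<otimes> c [^] k = c [^] Suc k"
    using assms(3) by (metis nat_pow_Suc2)
  finally show ?case .
qed

lemma (in group) central_commutator_coprime:
  assumes "x \<in> carrier G" "y \<in> carrier G" "c \<in> carrier G"
    and "x \<otimes> y = c \<otimes> (y \<otimes> x)" "c \<otimes> x = x \<otimes> c" "c \<otimes> y = y \<otimes> c"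
    and "x [^] m = \<one>" "y [^] n = \<one>" "coprime m (n::nat)"
  shows "c = \<one>"
proof (rule pow_coprime_eq_one)
  have "y = c [^] m \<otimes> y"
    using central_commutator_pow[OF assms(1-5), of m] assms(1-3,7) by simp
  then show "c [^] m = \<one>"
    using assms(2,3) by (metis nat_pow_closed l_one one_closed right_cancel)
  have "y \<otimes> x = inv c \<otimes> (x \<otimes> y)"
    using assms(1-4) by (simp add: m_assoc[symmetric])
  moreover have "inv c \<otimes> y = y \<otimes> inv c"
    using assms(2,3,6) by (metis inv_closed inv_solve_left inv_solve_right m_assoc m_closed)
  ultimately have "y [^] n \<otimes> x = inv c [^] n \<otimes> (x \<otimes> y [^] n)"
    using assms(1-3) by (intro central_commutator_pow) auto
  then have "x = inv c [^] n \<otimes> x"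
    using assms(1-3,8) by simp
  then have "inv c [^] n = \<one>"
    using assms(1,3) by (metis inv_closed nat_pow_closed l_one one_closed right_cancel)
  then show "c [^] n = \<one>"
    using assms(3) by (metis inv_eq_1_iff nat_pow_closed nat_pow_inv)
qed (use assms in auto)

text \<open>The commutator of \<open>x\<close> and \<open>y\<close> lies in every term of the lower central series: modulo the
  next term it is central, hence trivial because its order divides two coprime numbers.\<close>

lemma (in group) nilpotent_coprime_commute:
  assumes "nilpotent G" "x \<in> carrier G" "y \<in> carrier G"
    and "x [^] m = \<one>" "y [^] n = \<one>" "coprime m (n::nat)"
  shows "x \<otimes> y = y \<otimes> x"
proof -
  define c where "c = x \<otimes> y \<otimes> inv x \<otimes> inv y"
  have cG: "c \<in> carrier G" and xy: "x \<otimes> y = c \<otimes> (y \<otimes> x)"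
    using assms(2,3) by (simp_all add: c_def m_assoc inv_mult_cancel)
  have "c \<in> lower_central_series G k" for k
  proof (induction k)
    case 0
    then show ?case using cG by simp
  next
    case (Suc k)
    define N where "N = lower_central_series G (Suc k)"
    interpret N: normal N G
      unfolding N_def by (rule normal_lower_central_series)
    interpret Q: group "G Mod N" by (rule N.factorgroup_is_group)
    interpret h: group_hom G "G Mod N" "\<lambda>g. N #> g"
      by unfold_locales (rule N.r_coset_hom_Mod)
    have comm: "(N #> c) \<otimes>\<^bsub>G Mod N\<^esub> (N #> g) = (N #> g) \<otimes>\<^bsub>G Mod N\<^esub> (N #> c)" if "g \<in> carrier G" for g
      using N.FactGroup_commute_iff[OF cG that] commutator_in_lower_central_series[OF Suc that]
      by (simp add: N_def)
    have "N #> c = \<one>\<^bsub>G Mod N\<^esub>"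
    proof (rule Q.central_commutator_coprime[OF _ _ _ _ _ _ _ _ assms(6)])
      show "(N #> x) \<otimes>\<^bsub>G Mod N\<^esub> (N #> y) = (N #> c) \<otimes>\<^bsub>G Mod N\<^esub> ((N #> y) \<otimes>\<^bsub>G Mod N\<^esub> (N #> x))"
        using assms(2,3) cG xy by (metis h.hom_mult m_closed)
      show "(N #> x) [^]\<^bsub>G Mod N\<^esub> m = \<one>\<^bsub>G Mod N\<^esub>"
        using assms(2,4) by (metis h.hom_nat_pow h.hom_one)
      show "(N #> y) [^]\<^bsub>G Mod N\<^esub> n = \<one>\<^bsub>G Mod N\<^esub>"
        using assms(3,5) by (metis h.hom_nat_pow h.hom_one)
    qed (use comm assms(2,3) cG in auto)
    then show ?case
      using cG N.is_subgroup coset_join1 by (simp add: N_def)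
  qed
  then have "c = \<one>"
    using assms(1) unfolding nilpotent_def by blast
  then show ?thesis
    using xy assms(2,3) by simp
qed

section \<open>A criterion for nilpotency\<close>

lemma (in group) subgroup_pow_card:
  assumes "subgroup H G" "x \<in> H"
  shows "x [^] card H = \<one>"
proof -
  interpret H: group "G\<lparr>carrier := H\<rparr>" using assms(1) by (rule subgroup_imp_group)
  show ?thesis
    using H.pow_order_eq_1[of x] assms(2) nat_pow_consistent[of x "card H" H] by (simp add: order_def)
qed

lemma dvd_of_prime_powers:
  assumes "n \<noteq> (0::nat)" "\<And>p k. Factorial_Ring.prime p \<Longrightarrow> p ^ k dvd n \<Longrightarrow> p ^ k dvd m"
  shows "n dvd m"
proof (cases "m = 0")
  case False
  show ?thesis
  proof (rule multiplicity_le_imp_dvd[OF assms(1)])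
    fix p :: nat assume p: "Factorial_Ring.prime p"
    then have "p ^ multiplicity p n dvd m"
      by (intro assms(2) multiplicity_dvd)
    then show "multiplicity p n \<le> multiplicity p m"
      using p False by (intro multiplicity_geI) auto
  qed
qed simp

text \<open>The conjugacy classes partition \<open>G\<close> into sets whose sizes are powers of \<open>p\<close>. If \<open>\<one>\<close> were
  the only central element, exactly one of these sizes would be \<open>1\<close>, and \<open>p\<close> would divide all others
  and their total.\<close>

lemma (in group) p_group_center_nontrivial:
  assumes p: "Factorial_Ring.prime p" and card: "order G = p ^ k" and k: "k > 0"
  obtains z where "z \<in> carrier G" "z \<noteq> \<one>" "\<And>g. g \<in> carrier G \<Longrightarrow> g \<otimes> z = z \<otimes> g"
proof (rule ccontr)
  assume "\<not> thesis"
  then have noncentral: "\<exists>g\<in>carrier G. g \<otimes> z \<noteq> z \<otimes> g" if "z \<in> carrier G" "z \<noteq> \<one>" for z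
    using that \<open>\<And>z. \<lbrakk>z \<in> carrier G; z \<noteq> \<one>; \<And>g. g \<in> carrier G \<Longrightarrow> g \<otimes> z = z \<otimes> g\<rbrakk> \<Longrightarrow> thesis\<close> by blast
  define \<phi> where "\<phi> = (\<lambda>g. \<lambda>h\<in>carrier G. g \<otimes> h \<otimes> inv g)"
  interpret act: group_action G "carrier G" \<phi>
    unfolding \<phi>_def by (rule action_by_conjugation)
  have fin: "finite (carrier G)"
    using card p by (metis order_gt_0_iff_finite prime_gt_0_nat zero_less_power)
  have orbit_one: "orbit G \<phi> \<one> = {\<one>}"
    by (auto simp: orbit_def \<phi>_def intro!: exI[of _ \<one>])
  have orbit_dvd: "p dvd card (orbit G \<phi> z)" if z: "z \<in> carrier G" "z \<noteq> \<one>" for z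
  proof -
    have "card (orbit G \<phi> z) dvd p ^ k"
      using act.orbit_stabilizer_theorem[OF z(1)] card by (metis dvd_triv_left)
    then obtain i where i: "card (orbit G \<phi> z) = p ^ i"
      using p by (metis divides_primepow_nat)
    obtain g where g: "g \<in> carrier G" "g \<otimes> z \<noteq> z \<otimes> g"
      using noncentral[OF z] by blast
    have "g \<otimes> z \<otimes> inv g \<noteq> z"
      using g z inv_solve_right'[of z "g \<otimes> z" g] by auto
    moreover have "g \<otimes> z \<otimes> inv g \<in> orbit G \<phi> z"
      using g z by (auto simp: orbit_def \<phi>_def)
    moreover have "z \<in> orbit G \<phi> z"
      using z by (rule_tac act.orbit_refl)
    ultimately have "card (orbit G \<phi> z) \<noteq> 1"
      by (metis card_1_singletonE singletonD)
    then show ?thesis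
      using i by (cases i) auto
  qed
  let ?O = "orbits G (carrier G) \<phi>"
  have finO: "finite ?O"
    using fin by (simp add: orbits_def setcompr_eq_image)
  have one_in: "{\<one>} \<in> ?O"
    using orbit_one by (auto simp: orbits_def)
  have "p ^ k = (\<Sum>orb\<in>?O. card orb)"
    using act.disjoint_sum[OF fin, of "\<lambda>_. 1::nat"] card by (simp add: order_def)
  also have "\<dots> = 1 + (\<Sum>orb\<in>?O - {{\<one>}}. card orb)"
    using finO one_in by (simp add: sum.remove)
  finally have "p ^ k = 1 + (\<Sum>orb\<in>?O - {{\<one>}}. card orb)" .
  moreover have "p dvd (\<Sum>orb\<in>?O - {{\<one>}}. card orb)"
  proof (rule dvd_sum)
    fix orb assume "orb \<in> ?O - {{\<one>}}"
    then obtain z where "z \<in> carrier G" "orb = orbit G \<phi> z" "orb \<noteq> {\<one>}"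
      by (auto simp: orbits_def)
    then show "p dvd card orb"
      using orbit_dvd orbit_one by metis
  qed
  moreover have "p dvd p ^ k"
    using k by simp
  ultimately have "p dvd 1"
    by (metis dvd_add_left_iff)
  then show False
    using p by simp
qed

text \<open>An elementwise form of being the direct product of the Sylow subgroups, which is easy to pass on to
  quotients. That the order of \<open>x\<close> is a power of \<open>p\<close> is expressed by
  \<open>x\<close> being killed by some \<open>p ^ a\<close>.\<close>

definition primary_commuting :: "('a, 'b) monoid_scheme \<Rightarrow> bool" where
  "primary_commuting G \<longleftrightarrow>
     (\<forall>p q a b. \<forall>x\<in>carrier G. \<forall>y\<in>carrier G.
        Factorial_Ring.prime p \<longrightarrow> Factorial_Ring.prime q \<longrightarrow> p \<noteq> q \<longrightarrow>
        x [^]\<^bsub>G\<^esub> (p ^ a :: nat) = \<one>\<^bsub>G\<^esub> \<longrightarrow> y [^]\<^bsub>G\<^esub> (q ^ b :: nat) = \<one>\<^bsub>G\<^esub> \<longrightarrow>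
        x \<otimes>\<^bsub>G\<^esub> y = y \<otimes>\<^bsub>G\<^esub> x)"

lemma (in group) centralizer_is_subgroup:
  assumes "z \<in> carrier G"
  shows "subgroup {g \<in> carrier G. g \<otimes> z = z \<otimes> g} G"
proof
  fix g h assume g: "g \<in> {g \<in> carrier G. g \<otimes> z = z \<otimes> g}" and h: "h \<in> {g \<in> carrier G. g \<otimes> z = z \<otimes> g}"
  then have "g \<otimes> h \<otimes> z = g \<otimes> (z \<otimes> h)" using assms by (simp add: m_assoc)
  also have "\<dots> = z \<otimes> (g \<otimes> h)" using assms g h by (simp add: m_assoc[symmetric])
  finally show "g \<otimes> h \<in> {g \<in> carrier G. g \<otimes> z = z \<otimes> g}" using g h by simp
next
  fix g assume g: "g \<in> {g \<in> carrier G. g \<otimes> z = z \<otimes> g}"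
  then have gG: "g \<in> carrier G" by simp
  then have "inv g \<otimes> z = inv g \<otimes> (z \<otimes> g) \<otimes> inv g"
    using assms by (simp add: m_assoc)
  also have "z \<otimes> g = g \<otimes> z"
    using g by simp
  also have "inv g \<otimes> (g \<otimes> z) \<otimes> inv g = z \<otimes> inv g"
    using gG assms by (simp add: m_assoc inv_mult_cancel)
  finally show "inv g \<in> {g \<in> carrier G. g \<otimes> z = z \<otimes> g}" using g by simp
qed (use assms in auto)

text \<open>A central element \<open>z\<close> of a Sylow \<open>p\<close>-subgroup also commutes with the elements whose order is a
  power of another prime. So its centralizer contains a Sylow subgroup for every prime and is the whole group.\<close>

lemma (in group) primary_commuting_center_nontrivial:
  assumes fin: "finite (carrier G)" and nontriv: "carrier G \<noteq> {\<one>}" and comm: "primary_commuting G"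
  obtains z where "z \<in> carrier G" "z \<noteq> \<one>" "\<And>g. g \<in> carrier G \<Longrightarrow> g \<otimes> z = z \<otimes> g"
proof -
  have order_pos: "order G > 0" using fin order_gt_0_iff_finite by blast
  have "order G \<noteq> 1" using nontriv order_one_triv_iff by blast
  then obtain p where p: "Factorial_Ring.prime p" "p dvd order G" using prime_factor_nat by blast
  obtain a m where am: "order G = p ^ a * m" "\<not> p dvd m"
    using multiplicity_decompose'[of "order G" p] p order_pos
    by (metis bot_nat_0.not_eq_extremum not_prime_unit)
  then have a: "a > 0" using p(2) by (cases a) auto
  obtain P where P: "subgroup P G" "card P = p ^ a"
    using sylow_thm[OF p(1) is_group am(1) fin] by blast
  interpret P: group "G\<lparr>carrier := P\<rparr>" using P(1) by (rule subgroup_imp_group)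
  obtain z where z: "z \<in> P" "z \<noteq> \<one>" and zP: "\<And>g. g \<in> P \<Longrightarrow> g \<otimes> z = z \<otimes> g"
    using P.p_group_center_nontrivial[OF p(1) _ a] P(2) by (auto simp: order_def)
  have zG: "z \<in> carrier G" using z P subgroup.subset by blast
  define C where "C = {g \<in> carrier G. g \<otimes> z = z \<otimes> g}"
  have C: "subgroup C G" unfolding C_def using zG by (rule centralizer_is_subgroup)
  have card_dvd: "card H dvd card C" if H: "subgroup H G" "H \<subseteq> C" for H
  proof -
    have "card (rcosets\<^bsub>G\<lparr>carrier := C\<rparr>\<^esub> H) * card H = card C"
      using group.lagrange[OF subgroup_imp_group[OF C] subgroup_incl[OF H(1) C H(2)]]
      by (simp add: order_def)
    then show ?thesis by (metis dvd_triv_right)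
  qed
  have "order G dvd card C"
  proof (rule dvd_of_prime_powers)
    fix q k assume q: "Factorial_Ring.prime (q::nat)" "q ^ k dvd order G"
    show "q ^ k dvd card C"
    proof (cases "q = p")
      case True
      have "coprime (q ^ k) m"
        using True p(1) am(2) by (simp add: prime_imp_coprime)
      then have "q ^ k dvd p ^ a"
        using q(2) am(1) coprime_dvd_mult_left_iff by metis
      moreover have "P \<subseteq> C"
        unfolding C_def using zP P(1) subgroup.subset by blast
      ultimately show ?thesis
        using card_dvd[OF P(1)] P(2) dvd_trans by metis
    next
      case False
      obtain Q where Q: "subgroup Q G" "card Q = q ^ k"
        using sylow_thm[OF q(1) is_group _ fin] q(2) by (metis dvd_def)
      have "g \<otimes> z = z \<otimes> g" if g: "g \<in> Q" for g
      proof -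
        have "g [^] (q ^ k) = \<one>" "z [^] (p ^ a) = \<one>"
          using subgroup_pow_card[OF Q(1) g] subgroup_pow_card[OF P(1) z(1)] P(2) Q(2) by simp_all
        moreover have "g \<in> carrier G" using g Q(1) subgroup.subset by blast
        ultimately show ?thesis
          using comm zG p(1) q(1) False unfolding primary_commuting_def by metis
      qed
      then have "Q \<subseteq> C"
        unfolding C_def using Q(1) subgroup.subset by blast
      then show ?thesis
        using card_dvd[OF Q(1)] Q(2) by simp
    qed
  qed (use order_pos in simp)
  moreover have sub: "C \<subseteq> carrier G" unfolding C_def by blast
  moreover have "card C > 0"
    using subgroup.one_closed[OF C] finite_subset[OF sub fin] card_gt_0_iff by blast
  ultimately have "card (carrier G) \<le> card C"
    unfolding order_def by (intro dvd_imp_le)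
  then have "C = carrier G"
    using card_seteq[OF fin sub] by blast
  then show thesis
    using that zG z(2) unfolding C_def by blast
qed

text \<open>A primary element of a quotient lifts to a primary element: a power whose exponent is \<open>1\<close>
  modulo \<open>p ^ a\<close> lies in the same coset, and the exponent can be chosen divisible by the part of the
  group order prime to \<open>p\<close>.\<close>

lemma (in normal) primary_representative:
  assumes fin: "finite (carrier G)" and p: "Factorial_Ring.prime (p::nat)" and x: "x \<in> carrier G"
    and pow: "(H #> x) [^]\<^bsub>G Mod H\<^esub> (p ^ a) = \<one>\<^bsub>G Mod H\<^esub>"
  obtains y b where "y \<in> carrier G" "H #> y = H #> x" "y [^] (p ^ b) = \<one>"
proof -
  interpret Q: group "G Mod H" by (rule factorgroup_is_group)
  interpret h: group_hom G "G Mod H" "\<lambda>g. H #> g"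
    by unfold_locales (rule r_coset_hom_Mod)
  have "order G > 0" using fin order_gt_0_iff_finite by blast
  then obtain b m where bm: "order G = p ^ b * m" "\<not> p dvd m"
    using multiplicity_decompose'[of "order G" p] p
    by (metis bot_nat_0.not_eq_extremum not_prime_unit)
  have "coprime m (p ^ a)"
    using prime_imp_coprime[OF p bm(2)] by (simp add: coprime_commute)
  moreover have "m \<noteq> 0"
    using bm(2) by (metis dvd_0_right)
  ultimately obtain u v where uv: "m * u = p ^ a * v + 1"
    using bezout_nat[of m "p ^ a"] by auto
  have "(H #> x) [^]\<^bsub>G Mod H\<^esub> (m * u)
      = ((H #> x) [^]\<^bsub>G Mod H\<^esub> (p ^ a)) [^]\<^bsub>G Mod H\<^esub> v \<otimes>\<^bsub>G Mod H\<^esub> (H #> x)"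
    using h.hom_closed[OF x] by (simp add: uv Q.nat_pow_pow del: mult_FactGroup)
  also have "\<dots> = H #> x"
    using h.hom_closed[OF x] by (simp add: pow del: mult_FactGroup one_FactGroup)
  finally have "(H #> x) [^]\<^bsub>G Mod H\<^esub> (m * u) = H #> x" .
  then have "H #> (x [^] (m * u)) = H #> x"
    using x by (simp add: h.hom_nat_pow del: mult_FactGroup)
  moreover have "(x [^] (m * u)) [^] (p ^ b) = (x [^] order G) [^] u"
    using x by (simp add: nat_pow_pow bm(1) mult_ac)
  then have "(x [^] (m * u)) [^] (p ^ b) = \<one>"
    using x by (simp add: pow_order_eq_1)
  ultimately show thesis
    using that x by blast
qed

lemma (in normal) primary_commuting_FactGroup:
  assumes fin: "finite (carrier G)" and comm: "primary_commuting G"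
  shows "primary_commuting (G Mod H)"
  unfolding primary_commuting_def
proof (intro allI ballI impI)
  fix p q a b :: nat and U V
  assume UV: "U \<in> carrier (G Mod H)" "V \<in> carrier (G Mod H)"
    and pq: "Factorial_Ring.prime p" "Factorial_Ring.prime q" "p \<noteq> q"
    and pow: "U [^]\<^bsub>G Mod H\<^esub> (p ^ a) = \<one>\<^bsub>G Mod H\<^esub>" "V [^]\<^bsub>G Mod H\<^esub> (q ^ b) = \<one>\<^bsub>G Mod H\<^esub>"
  obtain x where x: "x \<in> carrier G" "U = H #> x" using UV(1) by (auto simp: carrier_FactGroup)
  obtain y where y: "y \<in> carrier G" "V = H #> y" using UV(2) by (auto simp: carrier_FactGroup)
  obtain x' a' where x': "x' \<in> carrier G" "H #> x' = U" "x' [^] (p ^ a') = \<one>"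
    using primary_representative[OF fin pq(1) x(1)] pow(1) x(2) by metis
  obtain y' b' where y': "y' \<in> carrier G" "H #> y' = V" "y' [^] (q ^ b') = \<one>"
    using primary_representative[OF fin pq(2) y(1)] pow(2) y(2) by metis
  have "x' \<otimes> y' = y' \<otimes> x'"
    using comm x' y' pq unfolding primary_commuting_def by blast
  then show "U \<otimes>\<^bsub>G Mod H\<^esub> V = V \<otimes>\<^bsub>G Mod H\<^esub> U"
    using rcos_sum x' y' by (metis mult_FactGroup)
qed

primrec upper_central_series :: "('a, 'b) monoid_scheme \<Rightarrow> nat \<Rightarrow> 'a set" where
  "upper_central_series G 0 = {\<one>\<^bsub>G\<^esub>}"
| "upper_central_series G (Suc n) =
     {g \<in> carrier G. \<forall>h\<in>carrier G.
        g \<otimes>\<^bsub>G\<^esub> h \<otimes>\<^bsub>G\<^esub> inv\<^bsub>G\<^esub> g \<otimes>\<^bsub>G\<^esub> inv\<^bsub>G\<^esub> h \<in> upper_central_series G n}"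

lemma (in normal) subgroup_commuting_mod:
  assumes "k \<in> carrier G"
  shows "subgroup {g \<in> carrier G. g \<otimes> k \<otimes> inv g \<otimes> inv k \<in> H} G" (is "subgroup ?S G")
proof -
  interpret Q: group "G Mod H" by (rule factorgroup_is_group)
  interpret h: group_hom G "G Mod H" "\<lambda>g. H #> g"
    by unfold_locales (rule r_coset_hom_Mod)
  define C where "C = {U \<in> carrier (G Mod H). U \<otimes>\<^bsub>G Mod H\<^esub> (H #> k) = (H #> k) \<otimes>\<^bsub>G Mod H\<^esub> U}"
  interpret C: subgroup C "G Mod H"
    unfolding C_def by (rule Q.centralizer_is_subgroup) (use assms h.hom_closed in blast)
  have mem: "g \<in> ?S \<longleftrightarrow> g \<in> carrier G \<and> H #> g \<in> C" for g
    using FactGroup_commute_iff[of g k] assms h.hom_closed[of g] unfolding C_def by blast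
  show ?thesis
  proof
    show "\<one> \<in> ?S" using C.one_closed h.hom_one unfolding mem by (metis one_closed)
    show "g \<otimes> g' \<in> ?S" if "g \<in> ?S" "g' \<in> ?S" for g g'
      using that C.m_closed h.hom_mult unfolding mem by (metis m_closed)
    show "inv g \<in> ?S" if "g \<in> ?S" for g
      using that C.m_inv_closed h.hom_inv unfolding mem by (metis inv_closed)
  qed auto
qed

lemma (in group) normal_upper_central_series: "upper_central_series G n \<lhd> G"
  and upper_central_series_Suc_mono: "upper_central_series G n \<subseteq> upper_central_series G (Suc n)"
proof -
  have mono: "upper_central_series G n \<subseteq> upper_central_series G (Suc n)"
    if "upper_central_series G n \<lhd> G" for n
  proof
    fix g assume g: "g \<in> upper_central_series G n"
    interpret U: normal "upper_central_series G n" G by (rule that)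
    have "g \<otimes> h \<otimes> inv g \<otimes> inv h \<in> upper_central_series G n" if h: "h \<in> carrier G" for h
    proof -
      have "g \<otimes> (h \<otimes> inv g \<otimes> inv h) \<in> upper_central_series G n"
        using g h U.inv_op_closed2 by blast
      then show ?thesis using g h U.mem_carrier by (simp add: m_assoc)
    qed
    then show "g \<in> upper_central_series G (Suc n)"
      using g U.mem_carrier by auto
  qed
  show normal: "upper_central_series G n \<lhd> G"
  proof (induction n)
    case 0
    then show ?case by (simp add: one_is_normal)
  next
    case (Suc n)
    let ?U = "upper_central_series G n"
    interpret U: normal ?U G by (rule Suc)
    have "upper_central_series G (Suc n) = (\<Inter>k\<in>carrier G. {g \<in> carrier G. g \<otimes> k \<otimes> inv g \<otimes> inv k \<in> ?U})"
      by auto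
    moreover have "subgroup \<dots> G"
      using U.subgroup_commuting_mod by (intro subgroups_Inter) auto
    ultimately have sub: "subgroup (upper_central_series G (Suc n)) G" by simp
    show ?case
    proof (rule normal_invI[OF sub])
      fix x g assume x: "x \<in> carrier G" and g: "g \<in> upper_central_series G (Suc n)"
      then have gG: "g \<in> carrier G" by simp
      have "g \<otimes> x \<otimes> inv g \<otimes> inv x \<in> ?U" using x g by simp
      then have "inv (g \<otimes> x \<otimes> inv g \<otimes> inv x) \<in> upper_central_series G (Suc n)"
        using U.m_inv_closed mono[OF Suc] by blast
      then have "inv (g \<otimes> x \<otimes> inv g \<otimes> inv x) \<otimes> g \<in> upper_central_series G (Suc n)"
        using g sub subgroup.m_closed by fast
      moreover have "inv (g \<otimes> x \<otimes> inv g \<otimes> inv x) \<otimes> g = x \<otimes> g \<otimes> inv x"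
        using x gG by (simp add: inv_mult_group m_assoc inv_mult_cancel)
      ultimately show "x \<otimes> g \<otimes> inv x \<in> upper_central_series G (Suc n)" by simp
    qed
  qed
  show "upper_central_series G n \<subseteq> upper_central_series G (Suc n)"
    by (rule mono[OF normal])
qed

text \<open>The quotient by a proper term inherits the hypothesis, so it has a nontrivial central element,
  whose representatives lie in the next term.\<close>

lemma (in group) upper_central_series_strict:
  assumes fin: "finite (carrier G)" and comm: "primary_commuting G"
    and proper: "upper_central_series G n \<noteq> carrier G"
  shows "upper_central_series G n \<subset> upper_central_series G (Suc n)"
proof -
  let ?U = "upper_central_series G n"
  interpret U: normal ?U G by (rule normal_upper_central_series)
  interpret Q: group "G Mod ?U" by (rule U.factorgroup_is_group)
  interpret h: group_hom G "G Mod ?U" "\<lambda>g. ?U #> g"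
    by unfold_locales (rule U.r_coset_hom_Mod)
  obtain g where g: "g \<in> carrier G" "g \<notin> ?U" using proper U.subset by blast
  then have "?U #> g \<noteq> \<one>\<^bsub>G Mod ?U\<^esub>" using coset_join1 U.is_subgroup by auto
  then have "carrier (G Mod ?U) \<noteq> {\<one>\<^bsub>G Mod ?U\<^esub>}" using g h.hom_closed by blast
  moreover have "finite (carrier (G Mod ?U))"
    using fin by (simp add: carrier_FactGroup)
  ultimately obtain Z where Z: "Z \<in> carrier (G Mod ?U)" "Z \<noteq> \<one>\<^bsub>G Mod ?U\<^esub>"
    and central: "\<And>U. U \<in> carrier (G Mod ?U) \<Longrightarrow> U \<otimes>\<^bsub>G Mod ?U\<^esub> Z = Z \<otimes>\<^bsub>G Mod ?U\<^esub> U"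
    using Q.primary_commuting_center_nontrivial[OF _ _ U.primary_commuting_FactGroup[OF fin comm]] by blast
  obtain z where z: "z \<in> carrier G" "Z = ?U #> z" using Z(1) by (auto simp: carrier_FactGroup)
  have "z \<otimes> k \<otimes> inv z \<otimes> inv k \<in> ?U" if k: "k \<in> carrier G" for k
    using U.FactGroup_commute_iff[OF z(1) k] central[OF h.hom_closed[OF k]] z(2) by simp
  then have "z \<in> upper_central_series G (Suc n)" using z by simp
  moreover have "z \<notin> ?U" using Z(2) z coset_join2 U.is_subgroup by auto
  ultimately show ?thesis using upper_central_series_Suc_mono by blast
qed

text \<open>Each commutator step downwards from \<open>carrier G\<close> goes down one step of the upper series.\<close>
lemma (in group) lower_central_series_subset_upper:
  assumes "upper_central_series G n = carrier G" "i \<le> n"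
  shows "lower_central_series G i \<subseteq> upper_central_series G (n - i)"
  using assms(2)
proof (induction i)
  case 0
  then show ?case using assms(1) by simp
next
  case (Suc i)
  then have n: "n - i = Suc (n - Suc i)" by simp
  have IH: "lower_central_series G i \<subseteq> upper_central_series G (Suc (n - Suc i))"
    using Suc n by (metis Suc_leD)
  show ?case
    unfolding lower_central_series.simps commutator_subgroup_def
  proof (rule generate_subgroup_incl)
    show "subgroup (upper_central_series G (n - Suc i)) G"
      using normal_upper_central_series normal_imp_subgroup by blast
    show "(\<Union>h\<in>lower_central_series G i. \<Union>k\<in>carrier G. {h \<otimes> k \<otimes> inv h \<otimes> inv k})
        \<subseteq> upper_central_series G (n - Suc i)"
      using IH by auto
  qed
qed

text \<open>In a finite group the upper central series cannot grow forever, so it reaches \<open>carrier G\<close>, and the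
  lower central series then descends to \<open>\<one>\<close>. Arguing with the series inside \<open>G\<close> replaces an induction
  over quotients, whose elements have a different type.\<close>
lemma (in group) primary_commuting_nilpotent:
  assumes fin: "finite (carrier G)" and comm: "primary_commuting G"
  shows "nilpotent G"
proof -
  obtain n where n: "upper_central_series G n = carrier G"
  proof (rule ccontr)
    assume "\<not> thesis"
    then have proper: "upper_central_series G n \<noteq> carrier G" for n using that by blast
    have sub: "upper_central_series G n \<subseteq> carrier G" for n
      using normal_upper_central_series by (meson normal_imp_subgroup subgroup.subset)
    have "card (upper_central_series G n) \<ge> n" for n
    proof (induction n)
      case (Suc n)
      have "card (upper_central_series G n) < card (upper_central_series G (Suc n))"
        using upper_central_series_strict[OF fin comm proper] sub fin by (meson finite_subset psubset_card_mono)
      then show ?case using Suc by linarith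
    qed simp
    then have "n \<le> card (carrier G)" for n
      using sub fin by (meson card_mono le_trans)
    then show False by (meson not_less_eq_eq)
  qed
  have "lower_central_series G n \<subseteq> {\<one>}"
    using lower_central_series_subset_upper[OF n, of n] by simp
  moreover have "\<one> \<in> lower_central_series G n"
    using subgroup.one_closed[OF normal_imp_subgroup[OF normal_lower_central_series]] .
  ultimately show ?thesis
    using is_group unfolding nilpotent_def by blast
qed

text \<open>The criterion holds for want of instances: every element is killed by \<open>p ^ k\<close>, so only \<open>\<one>\<close> has
  order a power of another prime.\<close>
lemma (in group) prime_power_order_nilpotent:
  assumes p: "Factorial_Ring.prime p" and card: "order G = p ^ k"
  shows "nilpotent G"
proof (rule primary_commuting_nilpotent)
  show "finite (carrier G)"
    using card p by (metis order_gt_0_iff_finite prime_gt_0_nat zero_less_power)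
  have one: "x = \<one>" if x: "x \<in> carrier G" "x [^] (q ^ a) = \<one>" "Factorial_Ring.prime q" "q \<noteq> p" for x and q a :: nat
  proof (rule pow_coprime_eq_one[OF x(1,2)])
    show "x [^] (p ^ k) = \<one>" using pow_order_eq_1[OF x(1)] card by simp
    show "coprime (q ^ a) (p ^ k)" using p x(3,4) by (simp add: primes_coprime)
  qed
  show "primary_commuting G"
    unfolding primary_commuting_def by (metis one l_one r_one)
qed

section \<open>Nonabelian groups of order six\<close>

lemma (in group) pow_mod_exponent:
  assumes "x \<in> carrier G" "x [^] (m::nat) = \<one>"
  shows "x [^] (n mod m) = x [^] n"
proof -
  have "x [^] n = x [^] (m * (n div m) + n mod m)" by simp
  also have "\<dots> = (x [^] m) [^] (n div m) \<otimes> x [^] (n mod m)"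
    using assms(1) by (simp add: nat_pow_mult nat_pow_pow)
  finally show ?thesis using assms by simp
qed

text \<open>The six products \<open>x [^] i \<otimes> y [^] j\<close> are distinct, hence all elements of \<open>G\<close>. In particular
  \<open>y \<otimes> x\<close> is one of them, and as \<open>x\<close> and \<open>y\<close> do not commute it can only be \<open>x [^] 2 \<otimes> y\<close>.\<close>

lemma (in group) order_six_normal_form:
  assumes card: "order G = 6" and x: "x \<in> carrier G" "x [^] (3::nat) = \<one>" and y: "y \<in> carrier G" "y [^] (2::nat) = \<one>"
    and xy: "x \<otimes> y \<noteq> y \<otimes> x"
  shows "bij_betw (\<lambda>(i, j). x [^] i \<otimes> y [^] j) ({..<3::nat} \<times> {..<2::nat}) (carrier G)"
    and "y \<otimes> x = x [^] (2::nat) \<otimes> y"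
proof -
  let ?F = "\<lambda>(i::nat, j::nat). x [^] i \<otimes> y [^] j" and ?D = "{..<3::nat} \<times> {..<2::nat}"
  have ordx: "ord x = 3"
  proof -
    have "ord x dvd 3" using x by (simp add: pow_eq_id[symmetric])
    moreover have "ord x \<noteq> 1" using x(1) y(1) xy ord_eq_1 by auto
    moreover have "Factorial_Ring.prime (3::nat)" by simp
    ultimately show ?thesis by (metis prime_nat_iff)
  qed
  have xpow: "i = i'" if "x [^] i = x [^] i'" "i < 3" "i' < 3" for i i' :: nat
    using that ord_inj[OF x(1)] ordx by (force simp: inj_on_def)
  have y_notin: "y \<noteq> x [^] i" for i :: nat
    using xy x(1) by (metis nat_pow_comm nat_pow_eone)
  have y_cases: "j = j'" if "x [^] i \<otimes> y [^] j = x [^] i' \<otimes> y [^] j'" "j < 2" "j' < 2" "i < 3" "i' < 3" for i i' j j' :: nat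
  proof (rule ccontr)
    assume "j \<noteq> j'"
    have False if eq: "x [^] i \<otimes> y = x [^] i'" and i: "i < 3" for i i' :: nat
    proof -
      have "x [^] (3 - i) \<otimes> (x [^] i \<otimes> y) = x [^] (3 - i) \<otimes> x [^] i'" using eq by simp
      then have "x [^] (3 - i + i) \<otimes> y = x [^] (3 - i + i')"
        using x(1) y(1) by (simp add: m_assoc[symmetric] nat_pow_mult)
      then have "y = x [^] (3 - i + i')" using i x(2) y(1) by simp
      then show False using y_notin by blast
    qed
    then have "x [^] i \<otimes> y \<noteq> x [^] i'" "x [^] i' \<otimes> y \<noteq> x [^] i"
      using that(4,5) by blast+
    moreover have "j = 0 \<and> j' = 1 \<or> j = 1 \<and> j' = 0"
      using that(2,3) \<open>j \<noteq> j'\<close> by linarith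
    ultimately show False using that(1) x(1) y(1) by auto
  qed
  have inj: "inj_on ?F ?D"
  proof (rule inj_onI)
    fix s t assume st: "s \<in> ?D" "t \<in> ?D" "?F s = ?F t"
    obtain i j i' j' where s: "s = (i, j)" and t: "t = (i', j')" by fastforce
    have *: "i < 3" "j < 2" "i' < 3" "j' < 2"
      and eq: "x [^] i \<otimes> y [^] j = x [^] i' \<otimes> y [^] j'"
      using st unfolding s t by auto
    have "j = j'" using y_cases[OF eq] * by simp
    then have "x [^] i = x [^] i'" using eq x(1) y(1) by simp
    then show "s = t" using xpow * \<open>j = j'\<close> by (simp add: s t)
  qed
  have "card (?F ` ?D) = card (carrier G)"
    using card_image[OF inj] card by (simp add: order_def)
  moreover have "?F ` ?D \<subseteq> carrier G" using x(1) y(1) by auto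
  moreover have "finite (carrier G)" using card order_gt_0_iff_finite by force
  ultimately have "?F ` ?D = carrier G" using card_subset_eq by blast
  then show "bij_betw ?F ?D (carrier G)" using inj by (simp add: bij_betw_def)
  have "y \<otimes> x \<in> ?F ` ?D" using \<open>?F ` ?D = carrier G\<close> x(1) y(1) by auto
  then obtain i j :: nat where ij: "i < 3" "j < 2" "y \<otimes> x = x [^] i \<otimes> y [^] j" by auto
  have "j \<noteq> 0"
  proof
    assume "j = 0"
    then have "y \<otimes> x = x [^] i" using ij x(1) by simp
    then have "y \<otimes> x \<otimes> x [^] (2::nat) = x [^] (i + 2)" using x(1) by (simp add: nat_pow_mult)
    moreover have "y \<otimes> x \<otimes> x [^] (2::nat) = y \<otimes> x [^] (3::nat)"
      using x(1) y(1) by (simp add: m_assoc numeral_eq_Suc)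
    ultimately have "y = x [^] (i + 2)" using x(2) y(1) by (simp del: nat_pow_Suc add_2_eq_Suc')
    then show False using y_notin by blast
  qed
  then have j: "j = 1" using ij by simp
  have "i \<noteq> 0"
  proof
    assume "i = 0"
    then have "y \<otimes> x = y" using ij j y(1) by simp
    then show False using x(1) y(1) xy by (metis l_cancel_one r_one l_one)
  qed
  moreover have "i \<noteq> 1" using ij j x(1) y(1) xy by auto
  ultimately have "i = 2" using ij(1) by simp
  then show "y \<otimes> x = x [^] (2::nat) \<otimes> y" using ij j y(1) by simp
qed

text \<open>Conjugation by \<open>y\<close> squares \<open>x\<close>, so moving \<open>y [^] j\<close> to the right past \<open>x [^] k\<close> multiplies the exponent
  \<open>k\<close> by \<open>2 ^ j\<close>.\<close>
lemma (in group) order_six_mult: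
  fixes i j k l :: nat
  assumes x: "x \<in> carrier G" "x [^] (3::nat) = \<one>" and y: "y \<in> carrier G" "y [^] (2::nat) = \<one>"
    and yx: "y \<otimes> x = x [^] (2::nat) \<otimes> y"
  shows "(x [^] i \<otimes> y [^] j) \<otimes> (x [^] k \<otimes> y [^] l)
    = x [^] ((i + 2 ^ j * k) mod 3) \<otimes> y [^] ((j + l) mod (2::nat))"
proof -
  have 1: "y \<otimes> x [^] k = x [^] (2 * k) \<otimes> y" for k :: nat
  proof (induction k)
    case 0
    then show ?case using y by simp
  next
    case (Suc k)
    have "y \<otimes> x [^] Suc k = (y \<otimes> x [^] k) \<otimes> x" using x y by (simp add: m_assoc)
    also have "\<dots> = x [^] (2 * k) \<otimes> (x [^] (2::nat) \<otimes> y)" using x y by (simp add: Suc m_assoc yx)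
    also have "\<dots> = x [^] (2 * Suc k) \<otimes> y"
      using x y by (simp add: m_assoc[symmetric] nat_pow_mult)
    finally show ?case .
  qed
  have 2: "y [^] j \<otimes> x [^] k = x [^] (2 ^ j * k) \<otimes> y [^] j" for j k :: nat
  proof (induction j arbitrary: k)
    case 0
    then show ?case using x by simp
  next
    case (Suc j)
    have "y [^] Suc j \<otimes> x [^] k = y [^] j \<otimes> (y \<otimes> x [^] k)" using x y by (simp add: m_assoc)
    also have "\<dots> = (y [^] j \<otimes> x [^] (2 * k)) \<otimes> y" using x y by (simp add: 1 m_assoc)
    also have "\<dots> = x [^] (2 ^ Suc j * k) \<otimes> y [^] Suc j"
      using x y by (simp add: Suc m_assoc mult_ac)
    finally show ?case .
  qed
  have "(x [^] i \<otimes> y [^] j) \<otimes> (x [^] k \<otimes> y [^] l) = x [^] i \<otimes> (y [^] j \<otimes> x [^] k) \<otimes> y [^] l"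
    using x y by (simp add: m_assoc)
  also have "\<dots> = (x [^] i \<otimes> x [^] (2 ^ j * k)) \<otimes> (y [^] j \<otimes> y [^] l)"
    using x y by (simp add: 2 m_assoc)
  also have "\<dots> = x [^] (i + 2 ^ j * k) \<otimes> y [^] (j + l)"
    using x y by (simp add: nat_pow_mult)
  finally show ?thesis
    using x y by (simp add: pow_mod_exponent)
qed

text \<open>In both groups the elements have the same normal forms, multiplied by the same rule on the
  exponents, so matching normal forms is an isomorphism.\<close>
lemma order_six_iso:
  assumes G: "group G" "order G = 6" "x \<in> carrier G" "y \<in> carrier G"
      "x [^]\<^bsub>G\<^esub> (3::nat) = \<one>\<^bsub>G\<^esub>" "y [^]\<^bsub>G\<^esub> (2::nat) = \<one>\<^bsub>G\<^esub>" "x \<otimes>\<^bsub>G\<^esub> y \<noteq> y \<otimes>\<^bsub>G\<^esub> x"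
    and H: "group H" "order H = 6" "u \<in> carrier H" "v \<in> carrier H"
      "u [^]\<^bsub>H\<^esub> (3::nat) = \<one>\<^bsub>H\<^esub>" "v [^]\<^bsub>H\<^esub> (2::nat) = \<one>\<^bsub>H\<^esub>" "u \<otimes>\<^bsub>H\<^esub> v \<noteq> v \<otimes>\<^bsub>H\<^esub> u"
  shows "G \<cong> H"
proof -
  define D where "D = {..<3::nat} \<times> {..<2::nat}"
  define e where "e = (\<lambda>(i, j). x [^]\<^bsub>G\<^esub> (i::nat) \<otimes>\<^bsub>G\<^esub> y [^]\<^bsub>G\<^esub> (j::nat))"
  define f where "f = (\<lambda>(i, j). u [^]\<^bsub>H\<^esub> (i::nat) \<otimes>\<^bsub>H\<^esub> v [^]\<^bsub>H\<^esub> (j::nat))"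
  define m where "m = (\<lambda>(i, j) (k, l). ((i + 2 ^ j * k) mod 3 :: nat, (j + l) mod 2 :: nat))"
  have e: "bij_betw e D (carrier G)"
    unfolding e_def D_def using G by (intro group.order_six_normal_form)
  have f: "bij_betw f D (carrier H)"
    unfolding f_def D_def using H by (intro group.order_six_normal_form)
  have em: "e a \<otimes>\<^bsub>G\<^esub> e b = e (m a b)" for a b
    using group.order_six_mult[OF G(1,3,5,4,6) group.order_six_normal_form(2)[OF G(1,2,3,5,4,6,7)]]
    unfolding e_def m_def by (auto split: prod.split)
  have fm: "f a \<otimes>\<^bsub>H\<^esub> f b = f (m a b)" for a b
    using group.order_six_mult[OF H(1,3,5,4,6) group.order_six_normal_form(2)[OF H(1,2,3,5,4,6,7)]]
    unfolding f_def m_def by (auto split: prod.split)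
  have mD: "m a b \<in> D" for a b by (auto simp: m_def D_def split: prod.split)
  define \<phi> where "\<phi> = f \<circ> inv_into D e"
  have \<phi>e: "\<phi> (e a) = f a" if "a \<in> D" for a
    using e that by (simp add: \<phi>_def bij_betw_def)
  have "bij_betw \<phi> (carrier G) (carrier H)"
    unfolding \<phi>_def using e f bij_betw_inv_into bij_betw_trans by blast
  moreover have "\<phi> (g \<otimes>\<^bsub>G\<^esub> h) = \<phi> g \<otimes>\<^bsub>H\<^esub> \<phi> h" if g: "g \<in> carrier G" and h: "h \<in> carrier G" for g h
  proof -
    obtain a where "a \<in> D" "g = e a" using e g by (metis bij_betw_imp_surj_on imageE)
    moreover obtain b where "b \<in> D" "h = e b" using e h by (metis bij_betw_imp_surj_on imageE)
    ultimately show ?thesis by (simp add: em fm \<phi>e mD)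
  qed
  ultimately have "\<phi> \<in> iso G H"
    by (auto simp: iso_def hom_def bij_betw_def)
  then show ?thesis by (auto simp: is_iso_def)
qed

text \<open>The non-commuting elements that the criterion provides have prime power orders dividing six, for
  distinct primes: one has order two and the other order three.\<close>
lemma (in group) order_six_not_nilpotent:
  assumes card: "order G = 6" and not_nil: "\<not> nilpotent G"
  obtains x y where "x \<in> carrier G" "y \<in> carrier G" "x [^] (3::nat) = \<one>" "y [^] (2::nat) = \<one>" "x \<otimes> y \<noteq> y \<otimes> x"
proof -
  have "finite (carrier G)" using card order_gt_0_iff_finite by force
  then have "\<not> primary_commuting G" using not_nil primary_commuting_nilpotent by blast
  then obtain p q :: nat and a b x y where pq: "Factorial_Ring.prime p" "Factorial_Ring.prime q" "p \<noteq> q"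
    and x: "x \<in> carrier G" "x [^] (p ^ a) = \<one>" and y: "y \<in> carrier G" "y [^] (q ^ b) = \<one>"
    and xy: "x \<otimes> y \<noteq> y \<otimes> x"
    unfolding primary_commuting_def by blast
  have primes: "Factorial_Ring.prime (2::nat)" "Factorial_Ring.prime (3::nat)" by simp_all
  have div6: "d = 1 \<or> d = 2 \<or> d = 3 \<or> d = 6" if "d dvd 6" for d :: nat
  proof -
    have "d \<le> 6" using that by (simp add: dvd_imp_le)
    then have "d \<in> {0, 1, 2, 3, 4, 5, 6}" by auto
    then show ?thesis using that by auto
  qed
  have ord23: "ord g = r \<and> (r = 2 \<or> r = 3)"
    if g: "g \<in> carrier G" "g [^] (r ^ c) = \<one>" "g \<noteq> \<one>" "Factorial_Ring.prime r" for g and r c :: nat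
  proof -
    have eq_r: "s = r" if "Factorial_Ring.prime s" "s dvd ord g" for s
      using that g primes_dvd_imp_eq prime_dvd_power dvd_trans pow_eq_id by metis
    have "ord g \<noteq> 1" using g ord_eq_1 by blast
    moreover have "ord g dvd 6" using ord_dvd_group_order[OF g(1)] card by simp
    ultimately consider "ord g = 2" | "ord g = 3" | "ord g = 6" using div6 by blast
    then show ?thesis
    proof cases
      case 3
      then have "2 = r" "3 = r" using eq_r[OF primes(1)] eq_r[OF primes(2)] by simp_all
      then show ?thesis by simp
    qed (use eq_r[OF primes(1)] eq_r[OF primes(2)] in auto)
  qed
  have "x \<noteq> \<one>" "y \<noteq> \<one>" using x y xy by auto
  then have "ord x = p" "p = 2 \<or> p = 3" "ord y = q" "q = 2 \<or> q = 3"
    using ord23 x y pq by blast+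
  then consider "ord x = 3" "ord y = 2" | "ord x = 2" "ord y = 3"
    using pq(3) by auto
  then show thesis
    using that[of x y] that[of y x] x(1) y(1) xy by cases (metis pow_ord_eq_1)+
qed

lemma order_six_iso_sym_group:
  assumes "group G" "order G = 6" "\<not> nilpotent G"
  shows "G \<cong> sym_group 3"
proof -
  obtain x y where xy: "x \<in> carrier G" "y \<in> carrier G" "x [^]\<^bsub>G\<^esub> (3::nat) = \<one>\<^bsub>G\<^esub>"
    "y [^]\<^bsub>G\<^esub> (2::nat) = \<one>\<^bsub>G\<^esub>" "x \<otimes>\<^bsub>G\<^esub> y \<noteq> y \<otimes>\<^bsub>G\<^esub> x"
    using group.order_six_not_nilpotent[OF assms] by metis
  \<comment> \<open>A transposition and a three-cycle.\<close>
  define t :: "nat \<Rightarrow> nat" where "t = transpose 1 2"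
  define c :: "nat \<Rightarrow> nat" where "c = transpose 1 2 \<circ> transpose 2 3"
  show ?thesis
  proof (rule order_six_iso[OF assms(1,2) xy sym_group_is_group])
    show "order (sym_group 3) = 6"
      by (simp add: order_def sym_group_card_carrier fact_numeral)
    show "c \<in> carrier (sym_group 3)" "t \<in> carrier (sym_group 3)"
      unfolding sym_group_carrier c_def t_def
      by (intro permutes_compose permutes_swap_id; simp)+
    show "c [^]\<^bsub>sym_group 3\<^esub> (3::nat) = \<one>\<^bsub>sym_group 3\<^esub>"
      by (rule ext) (simp add: numeral_3_eq_3 nat_pow_def sym_group_mult sym_group_one c_def transpose_def)
    show "t [^]\<^bsub>sym_group 3\<^esub> (2::nat) = \<one>\<^bsub>sym_group 3\<^esub>"
      by (simp add: numeral_2_eq_2 nat_pow_def sym_group_mult sym_group_one t_def)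
    have "(c \<circ> t) 1 \<noteq> (t \<circ> c) 1"
      by (simp add: c_def t_def transpose_def)
    then show "c \<otimes>\<^bsub>sym_group 3\<^esub> t \<noteq> t \<otimes>\<^bsub>sym_group 3\<^esub> c"
      unfolding sym_group_mult by metis
  qed
qed


section \<open>Adjacency in the nilpotent graph\<close>

text \<open>An element commutes with the subgroup generated by \<open>g\<close> and \<open>h\<close> as soon as it commutes with both.
  Applying this first to \<open>g\<close> and \<open>h\<close> and then to all elements of the subgroup shows that it is abelian.\<close>
lemma (in group) commuting_generate_nilpotent:
  assumes g: "g \<in> carrier G" and h: "h \<in> carrier G" and gh: "g \<otimes> h = h \<otimes> g"
  shows "nilpotent (G\<lparr>carrier := generate G {g, h}\<rparr>)"
proof -
  let ?K = "generate G {g, h}"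
  have K: "subgroup ?K G" using g h by (intro generate_is_subgroup) simp
  have gen: "u \<otimes> z = z \<otimes> u"
    if "u \<in> ?K" "z \<in> carrier G" "g \<otimes> z = z \<otimes> g" "h \<otimes> z = z \<otimes> h" for u z
    using generate_subgroup_incl[OF _ centralizer_is_subgroup[OF that(2)], of "{g, h}"] that g h by auto
  have "u \<otimes> v = v \<otimes> u" if u: "u \<in> ?K" and v: "v \<in> ?K" for u v
  proof (rule gen[OF u])
    show vG: "v \<in> carrier G" using v K subgroup.subset by blast
    show "g \<otimes> v = v \<otimes> g" "h \<otimes> v = v \<otimes> h"
      using gen[OF v] g h gh by metis+
  qed
  then show ?thesis
    using group.nilpotent_abelian[OF subgroup_imp_group[OF K]] by simp
qed

text \<open>Two adjacent vertices of a non-nilpotent group of order six generate a subgroup of order three,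
  which consists of them and \<open>\<one>\<close>. So edges join a vertex to its inverse, and any injection of the
  vertices into a linear order yields a bipartition: vertices smaller than their inverse, and the others.\<close>

lemma (in group) order_six_bipartite:
  assumes card: "order G = 6" and not_nil: "\<not> nilpotent G"
  shows "bipartite (nilpotent_graph G)"
proof -
  have fin: "finite (carrier G)" using card order_gt_0_iff_finite by force
  have one: "\<one> \<in> nil_set G"
    using commuting_generate_nilpotent[OF one_closed] by (simp add: nil_set_def)
  have edge: "h = inv g \<and> g = inv h" if gh: "(g, h) \<in> parcs (nilpotent_graph G)" for g h
  proof -
    have g: "g \<in> carrier G" "g \<noteq> \<one>" and h: "h \<in> carrier G" "h \<noteq> \<one>" and "g \<noteq> h"
      and nil: "nilpotent (G\<lparr>carrier := generate G {g, h}\<rparr>)"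
      using gh one by (auto simp: nilpotent_graph_def)
    define K where "K = generate G {g, h}"
    have K: "subgroup K G" unfolding K_def using g h by (intro generate_is_subgroup) simp
    have finK: "finite K" using fin K subgroup.subset finite_subset by metis
    have "K \<noteq> carrier G" using nil not_nil unfolding K_def[symmetric] by auto
    then have "card K < 6"
      using K fin card psubset_card_mono[of "carrier G" K] subgroup.subset[OF K] by (auto simp: order_def)
    moreover have "card K dvd 6"
      using lagrange[OF K] card by (metis dvd_triv_right)
    moreover have sub: "{\<one>, g, h} \<subseteq> K"
      unfolding K_def by (auto intro: generate.intros)
    moreover have card3: "card {\<one>, g, h} = 3" using g h \<open>g \<noteq> h\<close> by auto
    moreover have "card K \<ge> 3" using card_mono[OF finK sub] card3 by simp
    ultimately have "card K = 3"
    proof -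
      assume *: "card K < 6" "card K dvd 6" "card K \<ge> 3"
      then have "card K \<in> {3, 4, 5}" by auto
      then show ?thesis using * by auto
    qed
    then have K_eq: "K = {\<one>, g, h}"
      using card_subset_eq[OF finK sub] card3 by simp
    have "g \<otimes> h \<in> K" using sub K subgroup.m_closed by fast
    moreover have "g \<otimes> h \<noteq> g" "g \<otimes> h \<noteq> h"
      using g h by (simp_all add: l_cancel_one r_cancel_one)
    ultimately have "g \<otimes> h = \<one>" using K_eq by auto
    then show ?thesis using g h by (metis inv_equality inv_inv)
  qed
  obtain f :: "'a \<Rightarrow> nat" where f: "inj_on f (carrier G)"
    using finite_imp_inj_to_nat_seg[OF fin] by blast
  let ?V = "pverts (nilpotent_graph G)"
  define A where "A = {g \<in> ?V. f g < f (inv g)}"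
  have "g \<in> A \<and> h \<in> ?V - A \<or> g \<in> ?V - A \<and> h \<in> A" if gh: "(g, h) \<in> parcs (nilpotent_graph G)" for g h
  proof -
    have V: "g \<in> ?V" "h \<in> ?V" and "g \<noteq> h" "g \<in> carrier G" "h \<in> carrier G"
      using gh by (auto simp: nilpotent_graph_def)
    then have "f g \<noteq> f h" using f by (auto simp: inj_on_def)
    then show ?thesis using V edge[OF gh] unfolding A_def by (metis (mono_tags, lifting) DiffI linorder_neqE_nat mem_Collect_eq order_less_asym)
  qed
  then show ?thesis
    unfolding bipartite_def by (intro exI[of _ A] exI[of _ "?V - A"]) (auto simp: A_def)
qed

text \<open>For \<open>u\<close> in the subgroup generated by \<open>g\<close>, the subgroup generated by \<open>u\<close> and \<open>h\<close> is contained in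
  the one generated by \<open>g\<close> and \<open>h\<close>.\<close>
lemma (in group) nil_set_generate:
  assumes g: "g \<in> nil_set G" and u: "u \<in> generate G {g}"
  shows "u \<in> nil_set G"
proof -
  have gG: "g \<in> carrier G" using g by (simp add: nil_set_def)
  then have uG: "u \<in> carrier G" using u generate_in_carrier by blast
  have "nilpotent (G\<lparr>carrier := generate G {u, h}\<rparr>)" if h: "h \<in> carrier G" for h
  proof (rule nilpotent_subgroup_mono)
    show L: "subgroup (generate G {g, h}) G" using gG h by (intro generate_is_subgroup) simp
    have "u \<in> generate G {g, h}" using u mono_generate[of "{g}" "{g, h}"] by blast
    then show "generate G {u, h} \<subseteq> generate G {g, h}"
      by (intro generate_subgroup_incl[OF _ L]) (auto intro: generate.incl)
    show "nilpotent (G\<lparr>carrier := generate G {g, h}\<rparr>)" using g h by (simp add: nil_set_def)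
  qed (use uG h generate_is_subgroup in simp)
  then show ?thesis using uG by (simp add: nil_set_def)
qed

lemma (in group) nil_set_pow: "g \<in> nil_set G \<Longrightarrow> g [^] (k::nat) \<in> nil_set G"
proof (rule nil_set_generate, assumption)
  assume "g \<in> nil_set G"
  then have g: "g \<in> carrier G" by (simp add: nil_set_def)
  show "g [^] k \<in> generate G {g}"
    by (induction k) (auto intro: generate.intros)
qed

lemma (in group) nil_set_coprime_commute:
  assumes x: "x \<in> nil_set G" and y: "y \<in> carrier G"
    and "x [^] m = \<one>" "y [^] n = \<one>" "coprime m (n::nat)"
  shows "x \<otimes> y = y \<otimes> x"
proof -
  let ?K = "generate G {x, y}"
  have K: "subgroup ?K G" using x y by (intro generate_is_subgroup) (simp add: nil_set_def)
  have "nilpotent (G\<lparr>carrier := ?K\<rparr>)" using x y by (simp add: nil_set_def)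
  moreover have "x \<in> ?K" "y \<in> ?K" by (auto intro: generate.incl)
  ultimately show ?thesis
    using group.nilpotent_coprime_commute[OF subgroup_imp_group[OF K], of x y m n] assms(3-5)
    by (simp flip: nat_pow_consistent)
qed

lemma (in group) nil_set_one: "\<one> \<in> nil_set G"
  using commuting_generate_nilpotent[OF one_closed] by (simp add: nil_set_def)

section \<open>Groups whose nilpotent graph has no triangle\<close>

locale triangle_free_nilpotent_graph = group +
  assumes finite_carrier: "finite (carrier G)"
    and no_triangle: "\<not> {(u, v), (u, w), (v, w)} \<subseteq> parcs (nilpotent_graph G)"
begin

lemma commuting_vertices_not_distinct:
  assumes "u \<in> carrier G - nil_set G" "v \<in> carrier G - nil_set G" "w \<in> carrier G - nil_set G"
    and "u \<otimes> v = v \<otimes> u" "u \<otimes> w = w \<otimes> u" "v \<otimes> w = w \<otimes> v"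
  shows "\<not> distinct [u, v, w]"
proof
  assume "distinct [u, v, w]"
  moreover have "(g, h) \<in> parcs (nilpotent_graph G)"
    if "g \<in> carrier G - nil_set G" "h \<in> carrier G - nil_set G" "g \<otimes> h = h \<otimes> g" "g \<noteq> h" for g h
    using that commuting_generate_nilpotent[of g h] by (simp add: nilpotent_graph_def)
  ultimately show False
    using no_triangle[of u v w] assms by simp
qed

text \<open>The inverse of \<open>x\<close> generates the same subgroup as \<open>x\<close>, and so does \<open>x \<otimes> x\<close> because the order of \<open>x\<close>
  is odd; so \<open>x\<close>, \<open>x \<otimes> x\<close> and \<open>inv x\<close> are commuting vertices. They are distinct unless the order of \<open>x\<close> divides
  two or three.\<close>
lemma odd_order_vertex_cube:
  assumes x: "x \<in> carrier G" "x \<notin> nil_set G" and n: "odd n" "x [^] (n::nat) = \<one>"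
  shows "x [^] (3::nat) = \<one>"
proof (rule ccontr)
  assume cube: "x [^] (3::nat) \<noteq> \<one>"
  have x1: "x \<noteq> \<one>" using x nil_set_one by blast
  have xx: "x [^] (2::nat) = x \<otimes> x" using x by (simp add: numeral_2_eq_2)
  have x2: "x \<otimes> x \<noteq> \<one>"
  proof
    assume "x \<otimes> x = \<one>"
    then have "x [^] (2::nat) = \<one>" using xx by simp
    then show False using pow_coprime_eq_one[OF x(1) _ n(2), of 2] n(1) x1 by simp
  qed
  have sq: "x \<otimes> x \<notin> nil_set G"
  proof
    (* As n is odd, x is the power of x \<otimes> x with exponent (n + 1) / 2. *)
    assume "x \<otimes> x \<in> nil_set G"
    then have "(x \<otimes> x) [^] Suc (n div 2) \<in> nil_set G" by (rule nil_set_pow)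
    moreover have "(x \<otimes> x) [^] Suc (n div 2) = x [^] (2 * Suc (n div 2))"
      using x nat_pow_pow[OF x(1), of 2] xx by metis
    moreover have "2 * Suc (n div 2) = n + 1" using n(1) by presburger
    then have "x [^] (2 * Suc (n div 2)) = x"
      using x n(2) by (simp del: mult_Suc_right)
    ultimately show False using x(2) by (simp only:)
  qed
  have "inv x \<notin> nil_set G"
    using nil_set_generate[of "inv x" x] generate.inv[of "inv x" "{inv x}" G] x by auto
  then have "\<not> distinct [x, x \<otimes> x, inv x]"
    using x sq by (intro commuting_vertices_not_distinct) (simp_all add: m_assoc inv_mult_cancel)
  moreover have "x \<noteq> x \<otimes> x" using x1 x(1) by simp
  moreover have "x \<noteq> inv x" using x2 x(1) by (metis r_inv)
  moreover have "x \<otimes> x \<noteq> inv x"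
  proof
    assume "x \<otimes> x = inv x"
    then have "x \<otimes> x \<otimes> x = \<one>" using x(1) by simp
    then show False using cube x(1) by (simp add: numeral_3_eq_3)
  qed
  ultimately show False by simp
qed

text \<open>Throughout, \<open>x\<close> is an element of order three, and \<open>y\<close> witnesses that \<open>x\<close> does not commute with all
  elements of order prime to three. Such a \<open>y\<close> keeps \<open>x\<close> out of \<open>nil_set G\<close>, also after multiplication
  of \<open>x\<close> by an element of order a power of three that commutes with \<open>x\<close> and \<open>y\<close>.\<close>
context
  fixes x y n
  assumes x: "x \<in> carrier G" "x [^] (3::nat) = \<one>"
    and y: "y \<in> carrier G" "y [^] (n::nat) = \<one>" and n: "coprime 3 n"
    and xy: "x \<otimes> y \<noteq> y \<otimes> x"
begin

lemma vertices: "x \<notin> nil_set G" "x [^] (2::nat) \<notin> nil_set G"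
proof -
  show 1: "x \<notin> nil_set G"
    using nil_set_coprime_commute[OF _ y(1) x(2) y(2) n] xy by blast
  have "(x [^] (2::nat)) [^] (2::nat) = x [^] (3::nat) \<otimes> x"
    using x(1) by (simp add: nat_pow_pow numeral_eq_Suc m_assoc)
  then show "x [^] (2::nat) \<notin> nil_set G"
    using nil_set_pow[of "x [^] (2::nat)" 2] 1 x by auto
qed

text \<open>Otherwise \<open>c\<close>, \<open>x\<close> and \<open>x [^] 2\<close> are commuting vertices.\<close>
lemma centralizer_nil:
  assumes c: "c \<in> carrier G" "c \<otimes> x = x \<otimes> c" "c \<notin> {x, x [^] (2::nat)}"
  shows "c \<in> nil_set G"
proof (rule ccontr)
  assume "c \<notin> nil_set G"
  moreover have "c \<otimes> x [^] (2::nat) = x [^] (2::nat) \<otimes> c" "x \<otimes> x [^] (2::nat) = x [^] (2::nat) \<otimes> x"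
    using c(1,2) x(1) group_commutes_pow[of x c 2] group_commutes_pow[of x x 2] by simp_all
  ultimately have "\<not> distinct [c, x, x [^] (2::nat)]"
    using c x(1) vertices by (intro commuting_vertices_not_distinct) simp_all
  moreover have "x \<noteq> x [^] (2::nat)"
    using x(1) vertices(1) nil_set_one by (auto simp: numeral_2_eq_2)
  ultimately show False using c(3) by simp
qed

text \<open>Suppose that \<open>c\<close> commutes with \<open>x\<close> and is not a power of \<open>x\<close>. Then neither is \<open>c \<otimes> x\<close>, so \<open>c\<close> and
  \<open>c \<otimes> x\<close> both lie in \<open>nil_set G\<close>. If the order of \<open>c\<close> is prime to three, a power of \<open>c \<otimes> x\<close> is \<open>x\<close> or
  \<open>x [^] 2\<close>, although these are vertices. The general case reduces to this one, because a power \<open>d\<close> of \<open>c\<close>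
  whose order is a power of three must be trivial: otherwise \<open>d\<close> and \<open>d \<otimes> x\<close> commute with \<open>y\<close>, being in
  \<open>nil_set G\<close> and of order prime to that of \<open>y\<close>, and hence so does \<open>x\<close>.\<close>
lemma self_centralizing:
  assumes c: "c \<in> carrier G" "c \<otimes> x = x \<otimes> c"
  shows "c \<in> {\<one>, x, x [^] (2::nat)}"
proof (rule ccontr)
  have product_nil: "d \<otimes> x \<in> nil_set G"
    if d: "d \<in> carrier G" "d \<otimes> x = x \<otimes> d" "d \<notin> {\<one>, x, x [^] (2::nat)}" for d
  proof (rule centralizer_nil)
    show "d \<otimes> x \<otimes> x = x \<otimes> (d \<otimes> x)" by (simp only: d(2) m_assoc[OF x(1) d(1) x(1)])
    show "d \<otimes> x \<notin> {x, x [^] (2::nat)}" using d(1,3) x(1) by (auto simp: numeral_2_eq_2)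
  qed (use d(1) x(1) in simp)
  assume c': "c \<notin> {\<one>, x, x [^] (2::nat)}"
  then have c_nil: "c \<in> nil_set G" using centralizer_nil c by blast
  have three_prime: "Factorial_Ring.prime (3::nat)" by simp
  obtain a m where am: "order G = 3 ^ a * m" "\<not> 3 dvd m"
    using multiplicity_decompose'[of "order G" "3::nat"] finite_carrier
    by (metis not_prime_unit order_gt_0_iff_finite not_less_zero three_prime)
  define d where "d = c [^] m"
  have d: "d \<in> carrier G" "d \<otimes> x = x \<otimes> d" "d \<in> nil_set G"
    unfolding d_def using c x(1) group_commutes_pow[of c x m] nil_set_pow[OF c_nil] by simp_all
  have "d [^] (3 ^ a :: nat) = c [^] order G"
    using c(1) by (simp add: d_def nat_pow_pow am(1) mult.commute)
  then have d_pow: "d [^] (3 ^ a :: nat) = \<one>" using c(1) pow_order_eq_1 by simp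
  have "d = \<one>"
  proof (rule ccontr)
    assume "d \<noteq> \<one>"
    then have dx: "d \<otimes> x \<in> nil_set G" using product_nil d vertices by blast
    have "(d \<otimes> x) [^] (3 ^ a * 3 :: nat) = d [^] (3 ^ a * 3 :: nat) \<otimes> x [^] (3 * 3 ^ a :: nat)"
      using pow_mult_distrib[OF d(2,1) x(1)] by (simp add: mult.commute)
    also have "\<dots> = \<one>"
      using d(1) x d_pow by (simp flip: nat_pow_pow)
    finally have "d \<otimes> x \<otimes> y = y \<otimes> (d \<otimes> x)"
      using nil_set_coprime_commute[OF dx y(1) _ y(2)] n by simp
    moreover have "d \<otimes> y = y \<otimes> d"
      using nil_set_coprime_commute[OF d(3) y(1) d_pow y(2)] n by simp
    ultimately have "d \<otimes> (x \<otimes> y) = d \<otimes> (y \<otimes> x)"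
      using d(1) x(1) y(1) by (metis m_assoc)
    then show False using d(1) x(1) y(1) xy by simp
  qed
  then have "(c \<otimes> x) [^] m = x [^] m"
    using pow_mult_distrib[OF c(2,1) x(1), of m] x(1) by (simp add: d_def)
  then have "x [^] m \<in> nil_set G"
    using nil_set_pow[OF product_nil[OF c c'], of m] by simp
  moreover have "m mod 3 = 1 \<or> m mod 3 = 2" using am(2) by presburger
  ultimately show False
    using vertices pow_mod_exponent[OF x, of m] x(1) by auto
qed

text \<open>A nontrivial central element \<open>z\<close> of the nilpotent subgroup generated by \<open>c\<close> and \<open>x\<close> centralizes
  \<open>x\<close>, so it is \<open>x\<close> or \<open>x [^] 2\<close>, and \<open>x\<close> is a power of \<open>z\<close>. Since \<open>c\<close> commutes with \<open>z\<close>, it commutes with \<open>x\<close>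
  and is itself a power of \<open>x\<close>; but \<open>x\<close> and \<open>x [^] 2\<close> are vertices.\<close>
lemma nil_set_trivial: "nil_set G = {\<one>}"
proof -
  have "c = \<one>" if c: "c \<in> nil_set G" for c
  proof -
    have cG: "c \<in> carrier G" using c by (simp add: nil_set_def)
    let ?K = "generate G {c, x}"
    have K: "subgroup ?K G" using cG x(1) by (intro generate_is_subgroup) simp
    have gens: "c \<in> ?K" "x \<in> ?K" by (auto intro: generate.incl)
    interpret K: group "G\<lparr>carrier := ?K\<rparr>" using K by (rule subgroup_imp_group)
    have "nilpotent (G\<lparr>carrier := ?K\<rparr>)" using c x(1) by (simp add: nil_set_def)
    moreover have "carrier (G\<lparr>carrier := ?K\<rparr>) \<noteq> {\<one>\<^bsub>G\<lparr>carrier := ?K\<rparr>\<^esub>}"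
      using gens(2) vertices(1) nil_set_one by auto
    ultimately obtain z where z: "z \<in> ?K" "z \<noteq> \<one>" and central: "\<And>g. g \<in> ?K \<Longrightarrow> z \<otimes> g = g \<otimes> z"
      using K.nilpotent_center_nontrivial by auto
    have zG: "z \<in> carrier G" using z(1) K subgroup.subset by blast
    then have "z \<in> {x, x [^] (2::nat)}"
      using self_centralizing[of z] central[OF gens(2)] z(2) by blast
    then have "x = z \<or> x = z [^] (2::nat)"
    proof
      assume "z \<in> {x [^] (2::nat)}"
      then have "z [^] (2::nat) = x [^] (3::nat) \<otimes> x"
        using x(1) by (simp add: nat_pow_pow numeral_eq_Suc m_assoc)
      then show ?thesis using x by simp
    qed simp
    then have "c \<otimes> x = x \<otimes> c"
      using central[OF gens(1)] group_commutes_pow[of z c 2] zG cG by auto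
    then have "c \<in> {\<one>, x, x [^] (2::nat)}"
      using self_centralizing cG by blast
    then show "c = \<one>" using c vertices by blast
  qed
  then show ?thesis using nil_set_one by blast
qed

text \<open>The subgroup \<open>P\<close> is nilpotent and all its elements except \<open>\<one>\<close> are vertices, so three of them would
  form a triangle.\<close>
lemma prime_power_subgroup_card:
  assumes P: "subgroup P G" "card P = p ^ k" and p: "Factorial_Ring.prime p"
  shows "p ^ k \<le> 3"
proof (rule ccontr)
  assume "\<not> p ^ k \<le> 3"
  then have "card (P - {\<one>}) \<ge> 3" using P by (simp add: subgroup.one_closed)
  then obtain T where T: "T \<subseteq> P - {\<one>}" "card T = 3"
    by (meson obtain_subset_with_card_n)
  then obtain u v w where uvw: "T = {u, v, w}" "u \<noteq> v" "v \<noteq> w" "u \<noteq> w"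
    by (auto simp: card_3_iff)
  have nil: "nilpotent (G\<lparr>carrier := P\<rparr>)"
    using group.prime_power_order_nilpotent[OF subgroup_imp_group[OF P(1)] p] P(2) by (simp add: order_def)
  have PG: "P \<subseteq> carrier G" using P(1) by (rule subgroup.subset)
  have "(g, h) \<in> parcs (nilpotent_graph G)" if gh: "g \<in> T" "h \<in> T" "g \<noteq> h" for g h
  proof -
    have "generate G {g, h} \<subseteq> P" using gh T(1) by (intro generate_subgroup_incl[OF _ P(1)]) auto
    moreover have "subgroup (generate G {g, h}) G"
      using gh T(1) PG by (intro generate_is_subgroup) auto
    ultimately have "nilpotent (G\<lparr>carrier := generate G {g, h}\<rparr>)"
      using nilpotent_subgroup_mono[OF _ P(1) _ nil] by blast
    then show ?thesis
      using gh T(1) PG by (auto simp: nilpotent_graph_def nil_set_trivial)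
  qed
  then show False using no_triangle[of u v w] uvw by simp
qed

text \<open>By Sylow's theorem every prime power dividing the order of \<open>G\<close> is the order of a subgroup, hence at
  most three. The divisors of six other than six itself are prime powers, and so are excluded by
  non-commuting elements of coprime order.\<close>
lemma order_eq_six: "order G = 6"
proof -
  have pos: "order G > 0" using finite_carrier order_gt_0_iff_finite by blast
  have "order G dvd 6"
  proof (rule dvd_of_prime_powers)
    fix p k assume p: "Factorial_Ring.prime (p::nat)" "p ^ k dvd order G"
    obtain P where "subgroup P G" "card P = p ^ k"
      using sylow_thm[OF p(1) is_group _ finite_carrier] p(2) by (metis dvd_def)
    then have "p ^ k \<le> 3" using prime_power_subgroup_card p(1) by blast
    moreover have "p ^ k > 0" using p(1) by (simp add: prime_gt_0_nat)
    ultimately have "p ^ k = 1 \<or> p ^ k = 2 \<or> p ^ k = 3" by linarith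
    then show "p ^ k dvd 6" by auto
  qed (use pos in simp)
  have "\<not> nilpotent G"
    using nilpotent_coprime_commute[OF _ x(1) y(1) x(2) y(2) n] xy by blast
  then have not_power: "order G \<noteq> p ^ k" if "Factorial_Ring.prime p" for p k
    using prime_power_order_nilpotent[OF that] by blast
  have "order G \<le> 6" using \<open>order G dvd 6\<close> by (simp add: dvd_imp_le)
  moreover have "order G \<noteq> 1" "order G \<noteq> 2" "order G \<noteq> 3"
    using not_power[of 2 0] not_power[of 2 1] not_power[of 3 1] by simp_all
  moreover have "order G \<noteq> 4" "order G \<noteq> 5" using \<open>order G dvd 6\<close> by auto
  ultimately show ?thesis using pos by linarith
qed

end

text \<open>The triangle of \<open>x\<close>, \<open>x [^] 2\<close> and \<open>inv x\<close> is what forces \<open>p\<close> to be three.\<close>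
lemma order_eq_six_of_odd_prime:
  assumes p: "Factorial_Ring.prime p" "odd p" and q: "Factorial_Ring.prime q" "p \<noteq> q"
    and x: "x \<in> carrier G" "x [^] (p ^ a :: nat) = \<one>" and y: "y \<in> carrier G" "y [^] (q ^ b :: nat) = \<one>"
    and xy: "x \<otimes> y \<noteq> y \<otimes> x"
  shows "order G = 6"
proof -
  have "coprime (p ^ a) (q ^ b)" using p q by (simp add: primes_coprime)
  then have "x \<notin> nil_set G"
    using nil_set_coprime_commute[OF _ y(1) x(2) y(2)] xy by blast
  then have cube: "x [^] (3::nat) = \<one>"
    using odd_order_vertex_cube[OF x(1) _ _ x(2)] p(2) by simp
  have three: "Factorial_Ring.prime (3::nat)" by simp
  have "p = 3"
  proof (rule ccontr)
    assume "p \<noteq> 3"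
    then have "coprime 3 (p ^ a)" using p(1) three by (simp add: primes_coprime)
    then have "x = \<one>" using pow_coprime_eq_one[OF x(1) cube x(2)] by blast
    then show False using xy y(1) by simp
  qed
  then have "coprime 3 (q ^ b)" using q three by (simp add: primes_coprime)
  then show ?thesis using order_eq_six[OF x(1) cube y _ xy] by blast
qed

lemma order_eq_six_of_not_nilpotent:
  assumes "\<not> nilpotent G"
  shows "order G = 6"
proof -
  obtain p q :: nat and a b x y where pq: "Factorial_Ring.prime p" "Factorial_Ring.prime q" "p \<noteq> q"
    and x: "x \<in> carrier G" "x [^] (p ^ a) = \<one>" and y: "y \<in> carrier G" "y [^] (q ^ b) = \<one>"
    and xy: "x \<otimes> y \<noteq> y \<otimes> x"
    using assms primary_commuting_nilpotent[OF finite_carrier] unfolding primary_commuting_def by blast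
  have "odd p \<or> odd q" using pq by (metis primes_dvd_imp_eq two_is_prime_nat)
  then show ?thesis
    using order_eq_six_of_odd_prime[OF pq(1) _ pq(2,3) x y xy]
      order_eq_six_of_odd_prime[OF pq(2) _ pq(1) pq(3)[symmetric] y x xy[symmetric]] by blast
qed

end

lemma bipartite_no_triangle:
  assumes "bipartite \<Gamma>"
  shows "\<not> {(u, v), (u, w), (v, w)} \<subseteq> parcs \<Gamma>"
proof
  assume "{(u, v), (u, w), (v, w)} \<subseteq> parcs \<Gamma>"
  then have arcs: "(u, v) \<in> parcs \<Gamma>" "(u, w) \<in> parcs \<Gamma>" "(v, w) \<in> parcs \<Gamma>" by simp_all
  obtain A B where "A \<inter> B = {}"
    and split: "\<forall>(u, v) \<in> parcs \<Gamma>. u \<in> A \<and> v \<in> B \<or> u \<in> B \<and> v \<in> A"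
    using assms unfolding bipartite_def by blast
  then show False
    using bspec[OF split arcs(1)] bspec[OF split arcs(2)] bspec[OF split arcs(3)] by auto
qed

theorem proposition2p1:
  fixes G :: "('a, 'b) monoid_scheme"
  assumes "group G" and "finite (carrier G)" and "\<not> nilpotent G"
  shows "bipartite (nilpotent_graph G) \<longleftrightarrow> G \<cong> sym_group 3"
proof
  assume "bipartite (nilpotent_graph G)"
  then have "triangle_free_nilpotent_graph G"
    using assms(1,2) bipartite_no_triangle
    by (intro triangle_free_nilpotent_graph.intro triangle_free_nilpotent_graph_axioms.intro)
  then have "order G = 6"
    using assms(3) by (rule triangle_free_nilpotent_graph.order_eq_six_of_not_nilpotent)
  then show "G \<cong> sym_group 3"
    using assms order_six_iso_sym_group by blast
next
  assume "G \<cong> sym_group 3"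
  then have "order G = order (sym_group 3)"
    unfolding is_iso_def using iso_same_order by blast
  also have "\<dots> = 6"
    by (simp add: order_def sym_group_card_carrier fact_numeral)
  finally show "bipartite (nilpotent_graph G)"
    using assms group.order_six_bipartite by blast
qed

end
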